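(* Let $A\in\mathbb{R}^{N\times N}$, with $N=n_1\cdots n_d$ ($n_1,\dots,n_d$ positive integers), be such that $\mathrm{tr}(A)=0$. Consider the following iterative procedure: 1. Take $X_k^{(0)}=0\in\mathbb{R}^{n_k\times n_k}$ for $1\le k\le d$. 2. For each $\ell\ge 1$ compute, successively for $i=1,\dots,d$, the matrix $U_i^{(\ell)}$ as $$U_i^{(\ell)}=\arg\min_{U_i\in\mathrm{span}\{\mathrm{id}_{n_i}\}^{\perp}}\left\|A-\left(\sum_{k=1}^{i-1}\mathrm{id}_{[n_k]}\otimes X_k^{(\ell)}+\mathrm{id}_{[n_i]}\otimes\left(X_i^{(\ell-1)}+U_i\right)+\sum_{k=i+1}^{d}\mathrm{id}_{[n_k]}\otimes X_k^{(\ell-1)}\right)\right\|_F,$$ and put $X_i^{(\ell)}=X_i^{(\ell-1)}+U_i^{(\ell)}$. Then $$\lim_{\ell\to\infty}\sum_{k=1}^d\mathrm{id}_{[n_k]}\otimes X_k^{(\ell)}=P_{\Delta}(A),$$ where $P_{\Delta}(A)$ is the orthogonal projection of $A$ on $\Delta=\bigoplus_{i=1}^d\mathrm{span}\{\mathrm{id}_N\}^{\perp_i}$.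
   Context: Fix a factorization $N=n_1\cdots n_d$; in $\mathrm{id}_n$ denotes the $n\times n$ identity matrix. For $B\in\mathbb{R}^{n_k\times n_k}$, the notation $\mathrm{id}_{[n_k]}\otimes B$ stands for the Kronecker product $\mathrm{id}_{n_1}\otimes\cdots\otimes\mathrm{id}_{n_{k-1}}\otimes B\otimes\mathrm{id}_{n_{k+1}}\otimes\cdots\otimes\mathrm{id}_{n_d}\in\mathbb{R}^{N\times N}$ (with $B$ in the $k$-th position). Every space $\mathbb{R}^{m\times m}$ carries the inner product $\langle A,B\rangle=\mathrm{tr}(A^{\top}B)$ with associated Frobenius norm $\|A\|_F=\sqrt{\mathrm{tr}(A^{\top}A)}$. $\mathrm{span}\{\mathrm{id}_{n_i}\}^{\perp}$ is the orthogonal complement of $\mathrm{span}\{\mathrm{id}_{n_i}\}$ in $\mathbb{R}^{n_i\times n_i}$. $\mathrm{span}\{\mathrm{id}_N\}^{\perp_i}$ is the orthogonal complement of $\mathrm{span}\{\mathrm{id}_N\}$ in the linear subspace $\{\mathrm{id}_{[n_i]}\otimes B: B\in\mathbb{R}^{n_i\times n_i}\}$ of $\mathbb{R}^{N\times N}$. For a linear subspace $\mathcal{U}\subset\mathbb{R}^{N\times N}$, the orthogonal projection is $P_{\mathcal{U}}(V)=\arg\min_{U\in\mathcal{U}}\|U-V\|_F$. *)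

theory Defs
  imports "Jordan_Normal_Form.VS_Connect" Complex_Main
begin

abbreviation mats :: "nat \<Rightarrow> (real, real mat) module" where
  "mats m \<equiv> module_mat TYPE(real) m m"

definition mat_tr :: "real mat \<Rightarrow> real" where
  "mat_tr A = (\<Sum>i<dim_row A. A $$ (i, i))"

definition frob_inner :: "real mat \<Rightarrow> real mat \<Rightarrow> real" where
  "frob_inner A B = mat_tr (A\<^sup>T * B)"

definition frob_norm :: "real mat \<Rightarrow> real" where
  "frob_norm A = sqrt (mat_tr (A\<^sup>T * A))"

definition kron :: "real mat \<Rightarrow> real mat \<Rightarrow> real mat" where
  "kron A B = mat (dim_row A * dim_row B) (dim_col A * dim_col B)
     (\<lambda>(i, j). A $$ (i div dim_row B, j div dim_col B) * B $$ (i mod dim_row B, j mod dim_col B))"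

(* The product over the empty list is the 1 x 1 identity. *)
definition kron_list :: "real mat list \<Rightarrow> real mat" where
  "kron_list Ms = foldr kron Ms (1\<^sub>m 1)"

(* The Kronecker product of the identities of sizes n 1, ..., n d in which the k-th factor is
   replaced by B; factors are numbered from 1 to d. *)
definition id_kron :: "(nat \<Rightarrow> nat) \<Rightarrow> nat \<Rightarrow> nat \<Rightarrow> real mat \<Rightarrow> real mat" where
  "id_kron n d k B = kron_list (map (\<lambda>j. if j = k then B else 1\<^sub>m (n j)) [1..<Suc d])"

(* LinearCombinations.module.span is the carrier-based linear span; the unqualified module.span is
   the type-class one from HOL. *)
definition span_id :: "nat \<Rightarrow> real mat set" where
  "span_id m = LinearCombinations.module.span class_ring (mats m) {1\<^sub>m m}"

definition orth_compl_in :: "real mat set \<Rightarrow> real mat set \<Rightarrow> real mat set" where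
  "orth_compl_in W S = {X \<in> W. \<forall>Y\<in>S. frob_inner Y X = 0}"

(* The complement of span {id_N}, with N the product of the n k, taken inside the matrices acting
   on factor i only and not in the whole N x N matrix space. *)
definition Delta_summand :: "(nat \<Rightarrow> nat) \<Rightarrow> nat \<Rightarrow> nat \<Rightarrow> real mat set" where
  "Delta_summand n d i =
     orth_compl_in (id_kron n d i ` carrier_mat (n i) (n i)) (span_id (\<Prod>k=1..d. n k))"

definition subspace_family_sum :: "nat \<Rightarrow> 'i set \<Rightarrow> ('i \<Rightarrow> real mat set) \<Rightarrow> real mat set" where
  "subspace_family_sum N I W = {\<Oplus>\<^bsub>mats N\<^esub>i\<in>I. Y i |Y. Y \<in> (\<Pi> i\<in>I. W i)}"

(* D is the internal direct sum of the family W: each element of D is a sum of elements of the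
   W i in exactly one way, and D contains all such sums. *)
definition is_internal_direct_sum ::
    "nat \<Rightarrow> 'i set \<Rightarrow> ('i \<Rightarrow> real mat set) \<Rightarrow> real mat set \<Rightarrow> bool" where
  "is_internal_direct_sum N I W D \<longleftrightarrow>
     D = subspace_family_sum N I W \<and>
     (\<forall>Z\<in>D. \<exists>!Y. Y \<in> (\<Pi>\<^sub>E i\<in>I. W i) \<and> Z = (\<Oplus>\<^bsub>mats N\<^esub>i\<in>I. Y i))"

definition Delta :: "(nat \<Rightarrow> nat) \<Rightarrow> nat \<Rightarrow> real mat set" where
  "Delta n d = subspace_family_sum (\<Prod>k=1..d. n k) {1..d} (Delta_summand n d)"

(* arg_min_on is a choice among the minimizers; for a linear subspace S of mats m and a V in
   mats m there is exactly one. *)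
definition orth_proj :: "real mat set \<Rightarrow> real mat \<Rightarrow> real mat" where
  "orth_proj S V = arg_min_on (\<lambda>U. frob_norm (U - V)) S"

end

theory Submission
  imports Defs
begin

text \<open>For distinct factors \<open>i\<close> and \<open>k\<close> the inner product of \<open>id_kron n d i B\<close> and \<open>id_kron n d k C\<close>
  is a multiple of \<open>mat_tr B * mat_tr C\<close>, so the summands of \<open>Delta\<close> are pairwise orthogonal and
  minimizing over one factor does not interfere with the others. Hence the first sweep already sets
  each \<open>X\<^sub>i\<close> to the rescaled partial trace of \<open>A\<close>, which is traceless because \<open>A\<close> is; the sum of
  these is the projection, and later sweeps change nothing.\<close>

text \<open>\<open>arg_min_on\<close> is a choice, so its value is known only once the minimizer is
  unique. Strict minimality supplies this, both for the updates of the iteration and for the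
  projection.\<close>

lemma arg_min_on_unique:
  fixes f :: "'a \<Rightarrow> real"
  assumes "k \<in> S" and "\<And>x. x \<in> S \<Longrightarrow> x \<noteq> k \<Longrightarrow> f k < f x"
  shows "arg_min_on f S = k"
  unfolding arg_min_on_def
proof (rule arg_minI)
  show "k \<in> S" by fact
  show "\<not> f y < f k" if "y \<in> S" for y
    using assms(2)[OF that] by (cases "y = k") auto
  show "x = k" if "x \<in> S" "\<forall>y. y \<in> S \<longrightarrow> \<not> f y < f x" for x
    using assms that by blast
qed

section \<open>The Frobenius inner product\<close>

text \<open>Written entrywise, the trace form becomes a double sum of reals, from which symmetry,
  bilinearity and definiteness are read off.\<close>

lemma frob_inner_eq_sum:
  assumes "A \<in> carrier_mat r c" "B \<in> carrier_mat r c"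
  shows "frob_inner A B = (\<Sum>i<r. \<Sum>j<c. A $$ (i, j) * B $$ (i, j))"
proof -
  have "frob_inner A B = (\<Sum>j<c. \<Sum>i<r. A $$ (i, j) * B $$ (i, j))"
    using assms by (auto simp: frob_inner_def mat_tr_def scalar_prod_def atLeast0LessThan
        intro!: sum.cong)
  then show ?thesis by (simp add: sum.swap[of _ "{..<c}"])
qed

lemma frob_inner_commute:
  assumes "A \<in> carrier_mat r c" "B \<in> carrier_mat r c"
  shows "frob_inner A B = frob_inner B A"
  using assms by (simp add: frob_inner_eq_sum[of _ r c] mult.commute)

lemma frob_inner_add_right:
  assumes "A \<in> carrier_mat r c" "B \<in> carrier_mat r c" "C \<in> carrier_mat r c"
  shows "frob_inner A (B + C) = frob_inner A B + frob_inner A C"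
  using assms by (simp add: frob_inner_eq_sum[of _ r c] sum.distrib algebra_simps)

lemma frob_inner_diff_right:
  assumes "A \<in> carrier_mat r c" "B \<in> carrier_mat r c" "C \<in> carrier_mat r c"
  shows "frob_inner A (B - C) = frob_inner A B - frob_inner A C"
proof -
  have "B - C \<in> carrier_mat r c"
    using assms by auto
  then show ?thesis
    using assms by (simp add: frob_inner_eq_sum[of _ r c] sum_subtractf algebra_simps)
qed

lemma frob_inner_diff_left:
  assumes "A \<in> carrier_mat r c" "B \<in> carrier_mat r c" "C \<in> carrier_mat r c"
  shows "frob_inner (A - B) C = frob_inner A C - frob_inner B C"
proof -
  have "A - B \<in> carrier_mat r c"
    using assms by auto
  then show ?thesis
    using assms frob_inner_diff_right[of C r c A B] by (simp add: frob_inner_commute[of _ r c C])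
qed

lemma frob_inner_smult_left:
  assumes "A \<in> carrier_mat r c" "B \<in> carrier_mat r c"
  shows "frob_inner (a \<cdot>\<^sub>m A) B = a * frob_inner A B"
  using assms by (simp add: frob_inner_eq_sum[of _ r c] sum_distrib_left mult.assoc)

lemma frob_inner_zero_right:
  assumes "A \<in> carrier_mat r c"
  shows "frob_inner A (0\<^sub>m r c) = 0"
  using assms by (simp add: frob_inner_eq_sum[of _ r c])

lemma frob_inner_self_ge_0:
  assumes "A \<in> carrier_mat r c"
  shows "frob_inner A A \<ge> 0"
  using assms by (simp add: frob_inner_eq_sum[of _ r c] sum_nonneg)

lemma frob_inner_self_eq_0_iff:
  assumes "A \<in> carrier_mat r c"
  shows "frob_inner A A = 0 \<longleftrightarrow> A = 0\<^sub>m r c"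
proof
  assume "frob_inner A A = 0"
  then have "(\<Sum>i<r. \<Sum>j<c. A $$ (i, j) * A $$ (i, j)) = 0"
    using assms by (simp add: frob_inner_eq_sum[of _ r c])
  then have "\<forall>i<r. \<forall>j<c. A $$ (i, j) = 0"
    by (simp add: sum_nonneg_eq_0_iff sum_nonneg)
  then show "A = 0\<^sub>m r c"
    using assms by (intro eq_matI) auto
qed (use assms frob_inner_zero_right in auto)

lemma frob_inner_self_diff_pos:
  assumes "A \<in> carrier_mat r c" "B \<in> carrier_mat r c" "A \<noteq> B"
  shows "frob_inner (A - B) (A - B) > 0"
proof -
  have "A - B \<noteq> 0\<^sub>m r c"
  proof
    assume "A - B = 0\<^sub>m r c"
    then have "(A - B) $$ (i, j) = 0" if "i < r" "j < c" for i j
      using that by simp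
    then have "A = B"
      using assms by (intro eq_matI) auto
    then show False using assms by simp
  qed
  moreover have "A - B \<in> carrier_mat r c"
    using assms by auto
  ultimately show ?thesis
    using frob_inner_self_ge_0[of "A - B" r c] frob_inner_self_eq_0_iff[of "A - B" r c] by linarith
qed

lemma frob_norm_eq: "frob_norm A = sqrt (frob_inner A A)"
  by (simp add: frob_norm_def frob_inner_def)

text \<open>Stated for a difference because competitors appear below as an optimal residual minus an
  orthogonal deviation.\<close>

lemma frob_pythagoras:
  assumes "A \<in> carrier_mat r c" "B \<in> carrier_mat r c" "frob_inner A B = 0"
  shows "frob_inner (A - B) (A - B) = frob_inner A A + frob_inner B B"
proof -
  have "A - B \<in> carrier_mat r c"
    using assms by auto
  then show ?thesis
    using assms frob_inner_commute[OF assms(1,2)]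
    by (simp add: frob_inner_diff_left[of _ r c] frob_inner_diff_right[of _ r c])
qed

text \<open>This turns orthogonality to the identity into tracelessness.\<close>

lemma mat_tr_eq_frob_inner:
  assumes "B \<in> carrier_mat m m"
  shows "mat_tr B = frob_inner (1\<^sub>m m) B"
  using assms by (simp add: frob_inner_def)

lemma frob_inner_one_one: "frob_inner (1\<^sub>m m) (1\<^sub>m m) = real m"
  by (simp add: frob_inner_def mat_tr_def)

lemma mat_tr_diff:
  assumes "A \<in> carrier_mat m m" "B \<in> carrier_mat m m"
  shows "mat_tr (A - B) = mat_tr A - mat_tr B"
  using assms by (simp add: mat_tr_def sum_subtractf)

section \<open>Sums of matrices in the carrier-based module\<close>

lemma abelian_group_mats: "abelian_group (mats m)"
  by (rule abelian_group_mat)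

lemma finsum_mats_closed:
  assumes "\<And>i. i \<in> I \<Longrightarrow> f i \<in> carrier_mat m m"
  shows "finsum (mats m) f I \<in> carrier_mat m m"
proof -
  interpret abelian_group "mats m" by (rule abelian_group_mats)
  show ?thesis
    using finsum_closed[of f I] assms by (auto simp: module_mat_simps)
qed

lemma finsum_mats_cong:
  assumes "\<And>i. i \<in> I \<Longrightarrow> f i = g i" "\<And>i. i \<in> I \<Longrightarrow> g i \<in> carrier_mat m m"
  shows "finsum (mats m) f I = finsum (mats m) g I"
proof -
  interpret abelian_group "mats m" by (rule abelian_group_mats)
  show ?thesis
    by (rule finsum_cong') (use assms in \<open>auto simp: module_mat_simps\<close>)
qed

text \<open>The bridge from carrier-based sums of matrices to ordinary sums of reals.\<close>

lemma frob_inner_finsum: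
  assumes "finite I" "Y \<in> carrier_mat m m" "\<And>i. i \<in> I \<Longrightarrow> f i \<in> carrier_mat m m"
  shows "frob_inner Y (finsum (mats m) f I) = (\<Sum>i\<in>I. frob_inner Y (f i))"
proof -
  interpret abelian_group "mats m" by (rule abelian_group_mats)
  show ?thesis using assms(1,3)
  proof (induction I)
    case empty
    then show ?case using assms(2) by (simp add: module_mat_simps frob_inner_zero_right)
  next
    case (insert i I)
    have "finsum (mats m) f (insert i I) = f i + finsum (mats m) f I"
      using insert by (subst finsum_insert) (auto simp: module_mat_simps)
    moreover have "finsum (mats m) f I \<in> carrier_mat m m"
      using insert by (intro finsum_mats_closed) auto
    ultimately show ?case
      using insert assms(2) by (simp add: frob_inner_add_right[of _ m m])
  qed
qed

lemma span_id_eq: "span_id m = range (\<lambda>a. a \<cdot>\<^sub>m 1\<^sub>m m)"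
proof -
  interpret V: vectorspace "class_ring :: real ring" "mats m" by (rule matrix_vs)
  have lc: "V.lincomb a {1\<^sub>m m} = a (1\<^sub>m m) \<cdot>\<^sub>m 1\<^sub>m m" for a
    unfolding V.lincomb_def
    by (subst V.finsum_insert) (auto simp: module_mat_simps)
  have "span_id m = {V.lincomb a {1\<^sub>m m} |a. a \<in> {1\<^sub>m m} \<rightarrow> carrier class_ring}"
    unfolding span_id_def by (rule V.finite_span) (auto simp: module_mat_simps)
  also have "\<dots> = range (\<lambda>a. a \<cdot>\<^sub>m 1\<^sub>m m)"
    unfolding lc by auto
  finally show ?thesis .
qed

text \<open>Serves twice: for the feasible set of each update, with \<open>W\<close> all matrices of
  size \<open>n i\<close>, and for \<open>Delta_summand\<close>, with \<open>W\<close> the image of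
  one factor.\<close>

lemma orth_compl_in_span_id:
  assumes "W \<subseteq> carrier_mat m m"
  shows "orth_compl_in W (span_id m) = {B \<in> W. mat_tr B = 0}"
proof -
  have "frob_inner (a \<cdot>\<^sub>m 1\<^sub>m m) B = a * mat_tr B" if "B \<in> W" for a B
    using assms that by (auto simp: frob_inner_smult_left[of _ m m] mat_tr_eq_frob_inner)
  then show ?thesis
    by (auto simp: orth_compl_in_def span_id_eq)
qed

section \<open>Kronecker products\<close>

lemma kron_carrier:
  assumes "A \<in> carrier_mat a a" "B \<in> carrier_mat b b"
  shows "kron A B \<in> carrier_mat (a * b) (a * b)"
  using assms by (auto simp: kron_def)

lemma kron_index:
  assumes "A \<in> carrier_mat a a" "B \<in> carrier_mat b b" "i < a * b" "j < a * b"
  shows "kron A B $$ (i, j) = A $$ (i div b, j div b) * B $$ (i mod b, j mod b)"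
  using assms by (auto simp: kron_def)

lemma div_mod_less_of_less_mult:
  fixes i a b :: nat
  assumes "i < a * b"
  shows "i div b < a" "i mod b < b"
proof -
  have "b > 0" using assms by (cases b) auto
  then show "i mod b < b" by simp
  show "i div b < a" using assms by (rule less_mult_imp_div_less)
qed

text \<open>The index \<open>p\<close> encodes the pair of its quotient and remainder by
  \<open>b\<close>; the range is cut into \<open>a\<close> blocks of length
  \<open>b\<close>.\<close>

lemma sum_div_mod:
  fixes g :: "nat \<Rightarrow> nat \<Rightarrow> 'a::comm_monoid_add"
  shows "(\<Sum>p<a * b. g (p div b) (p mod b)) = (\<Sum>i<a. \<Sum>j<b. g i j)"
proof -
  have "(\<Sum>p<a * b. g (p div b) (p mod b))
      = (\<Sum>i<a. \<Sum>p\<in>{i * b..<i * b + b}. g (p div b) (p mod b))"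
    by (rule sum.nat_group[symmetric])
  also have "\<dots> = (\<Sum>i<a. \<Sum>j<b. g i j)"
  proof (rule sum.cong[OF refl])
    fix i
    have "(\<Sum>p\<in>{i * b..<i * b + b}. g (p div b) (p mod b))
        = (\<Sum>j\<in>{0..<b}. g ((j + i * b) div b) ((j + i * b) mod b))"
      using sum.shift_bounds_nat_ivl[of "\<lambda>p. g (p div b) (p mod b)" 0 "i * b" b]
      by (simp add: add.commute)
    also have "\<dots> = (\<Sum>j<b. g i j)"
      by (auto simp: atLeast0LessThan intro!: sum.cong)
    finally show "(\<Sum>p\<in>{i * b..<i * b + b}. g (p div b) (p mod b)) = (\<Sum>j<b. g i j)" .
  qed
  finally show ?thesis .
qed

text \<open>Each summand splits into a factor in the quotients of the indices and one in their
  remainders, so the double sum factors.\<close>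

lemma frob_inner_kron:
  assumes "A \<in> carrier_mat a a" "B \<in> carrier_mat b b" "C \<in> carrier_mat a a" "D \<in> carrier_mat b b"
  shows "frob_inner (kron A B) (kron C D) = frob_inner A C * frob_inner B D"
proof -
  let ?F = "\<lambda>i k. A $$ (i, k) * C $$ (i, k)" and ?G = "\<lambda>j l. B $$ (j, l) * D $$ (j, l)"
  have "frob_inner (kron A B) (kron C D)
      = (\<Sum>p<a * b. \<Sum>q<a * b. ?F (p div b) (q div b) * ?G (p mod b) (q mod b))"
    using assms by (simp add: frob_inner_eq_sum[of _ "a * b" "a * b"] kron_carrier kron_index mult_ac
        cong: sum.cong_simp)
  \<comment> \<open>The row index becomes the pair \<open>(i, j)\<close> and the column index the
    pair \<open>(k, l)\<close>.\<close>
  also have "\<dots> = (\<Sum>i<a. \<Sum>j<b. \<Sum>k<a. \<Sum>l<b. ?F i k * ?G j l)"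
    using sum_div_mod[where g = "\<lambda>i j. \<Sum>k<a. \<Sum>l<b. ?F i k * ?G j l"]
    by (simp only: sum_div_mod[where g = "\<lambda>k l. ?F i k * ?G j l" for i j])
  also have "\<dots> = (\<Sum>i<a. \<Sum>k<a. ?F i k) * (\<Sum>j<b. \<Sum>l<b. ?G j l)"
    by (simp add: sum_product sum_distrib_left sum_distrib_right sum.swap[of _ "{..<a}" "{..<b}"])
  finally show ?thesis
    using assms by (simp add: frob_inner_eq_sum[of _ a a] frob_inner_eq_sum[of _ b b])
qed

lemma kron_list_Nil: "kron_list [] = 1\<^sub>m 1"
  and kron_list_Cons: "kron_list (M # Ms) = kron M (kron_list Ms)"
  by (simp_all add: kron_list_def)

lemma kron_list_carrier:
  assumes "\<And>j. j \<in> set js \<Longrightarrow> M j \<in> carrier_mat (n j) (n j)"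
  shows "kron_list (map M js) \<in> carrier_mat (prod_list (map n js)) (prod_list (map n js))"
  using assms by (induction js) (auto simp: kron_list_Nil kron_list_Cons intro!: kron_carrier)

lemma frob_inner_kron_list:
  assumes "\<And>j. j \<in> set js \<Longrightarrow> M j \<in> carrier_mat (n j) (n j)"
    and "\<And>j. j \<in> set js \<Longrightarrow> M' j \<in> carrier_mat (n j) (n j)"
  shows "frob_inner (kron_list (map M js)) (kron_list (map M' js))
    = prod_list (map (\<lambda>j. frob_inner (M j) (M' j)) js)"
  using assms
proof (induction js)
  case Nil
  then show ?case by (simp add: kron_list_Nil frob_inner_eq_sum[of _ 1 1])
next
  case (Cons j js)
  then show ?case
    using frob_inner_kron[of "M j" "n j" "kron_list (map M js)" "prod_list (map n js)"
        "M' j" "kron_list (map M' js)"] kron_list_carrier[of js M n] kron_list_carrier[of js M' n]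
    by (simp add: kron_list_Cons)
qed

lemma kron_one: "kron (1\<^sub>m a) (1\<^sub>m b) = 1\<^sub>m (a * b)"
proof (rule eq_matI)
  fix i j assume "i < dim_row (1\<^sub>m (a * b))" "j < dim_col (1\<^sub>m (a * b))"
  then have "i < a * b" "j < a * b" by simp_all
  moreover have "i = j \<longleftrightarrow> i div b = j div b \<and> i mod b = j mod b"
    by (metis div_mult_mod_eq)
  ultimately show "kron (1\<^sub>m a) (1\<^sub>m b) $$ (i, j) = 1\<^sub>m (a * b) $$ (i, j)"
    using div_mod_less_of_less_mult[of i a b] div_mod_less_of_less_mult[of j a b]
    by (auto simp: kron_index[of _ a _ b])
qed (auto simp: kron_def)

lemma kron_list_one: "kron_list (map (\<lambda>j. 1\<^sub>m (n j)) js) = 1\<^sub>m (prod_list (map n js))"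
  by (induction js) (auto simp: kron_list_Nil kron_list_Cons kron_one)

text \<open>The entries of a Kronecker product depend on one factor through a single entry of it, at a
  position and with a weight not depending on that factor; linearity in it is then immediate.\<close>

lemma kron_list_entry:
  assumes "distinct js" "k \<in> set js"
    and "\<And>j. j \<in> set js \<Longrightarrow> M j \<in> carrier_mat (n j) (n j)"
  obtains r w where "\<And>p. p < prod_list (map n js) \<Longrightarrow> r p < n k"
    and "\<And>B p q. B \<in> carrier_mat (n k) (n k) \<Longrightarrow> p < prod_list (map n js) \<Longrightarrow>
      q < prod_list (map n js) \<Longrightarrow> kron_list (map (M(k := B)) js) $$ (p, q) = B $$ (r p, r q) * w p q"
  using assms
proof (induction js arbitrary: thesis)
  case (Cons j js)
  let ?b = "prod_list (map n js)"
  have b: "prod_list (map n (j # js)) = n j * ?b" by simp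
  show ?case
  proof (cases "j = k")
    case True
    have M: "kron_list (map M js) \<in> carrier_mat ?b ?b"
      using Cons.prems by (intro kron_list_carrier) auto
    \<comment> \<open>By distinctness \<open>k\<close> does not recur in the tail, so the update
      leaves the tail unchanged.\<close>
    have "map (M(k := B)) js = map M js" for B
      using Cons.prems True by auto
    then have split: "kron_list (map (M(k := B)) (j # js)) = kron B (kron_list (map M js))" for B
      using True by (simp only: list.map kron_list_Cons fun_upd_same)
    show thesis
    \<comment> \<open>The varying factor is the head: its entry is read at the quotients, and the
      weight is the tail's entry at the remainders.\<close>
    proof (rule Cons.prems(1))
      show "p div ?b < n k" if "p < prod_list (map n (j # js))" for p
        using that True unfolding b by (auto dest: div_mod_less_of_less_mult)
      show "kron_list (map (M(k := B)) (j # js)) $$ (p, q)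
          = B $$ (p div ?b, q div ?b) * kron_list (map M js) $$ (p mod ?b, q mod ?b)"
        if "B \<in> carrier_mat (n k) (n k)" "p < prod_list (map n (j # js))"
          "q < prod_list (map n (j # js))" for B p q
        using that True unfolding b split by (intro kron_index[OF _ M]) auto
    qed
  next
    case False
    obtain r w where r: "\<And>p. p < ?b \<Longrightarrow> r p < n k"
      and w: "\<And>B p q. B \<in> carrier_mat (n k) (n k) \<Longrightarrow> p < ?b \<Longrightarrow> q < ?b \<Longrightarrow>
        kron_list (map (M(k := B)) js) $$ (p, q) = B $$ (r p, r q) * w p q"
    proof (rule Cons.IH)
      show "distinct js" "k \<in> set js" using Cons.prems(2,3) False by auto
      show "M j \<in> carrier_mat (n j) (n j)" if "j \<in> set js" for j
        using Cons.prems(4) that by simp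
    qed blast
    show thesis
    \<comment> \<open>The varying factor lies in the tail: its position comes from the remainders,
      and the weight is multiplied by the head's entry at the quotients.\<close>
    proof (rule Cons.prems(1))
      show "r (p mod ?b) < n k" if "p < prod_list (map n (j # js))" for p
        using that unfolding b by (intro r) (rule div_mod_less_of_less_mult)
      show "kron_list (map (M(k := B)) (j # js)) $$ (p, q)
          = B $$ (r (p mod ?b), r (q mod ?b)) * (M j $$ (p div ?b, q div ?b) * w (p mod ?b) (q mod ?b))"
        if B: "B \<in> carrier_mat (n k) (n k)" and p: "p < prod_list (map n (j # js))"
          and q: "q < prod_list (map n (j # js))" for B p q
      proof -
        have "kron_list (map (M(k := B)) js) \<in> carrier_mat ?b ?b"
          using Cons.prems(4) B by (intro kron_list_carrier) auto
        then have "kron_list (map (M(k := B)) (j # js)) $$ (p, q)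
            = M j $$ (p div ?b, q div ?b) * kron_list (map (M(k := B)) js) $$ (p mod ?b, q mod ?b)"
          using Cons.prems(4) False p q by (simp add: kron_list_Cons kron_index[of _ "n j" _ ?b])
        then show ?thesis
          using w[OF B, of "p mod ?b" "q mod ?b"] p q unfolding b
          by (simp add: div_mod_less_of_less_mult)
      qed
    qed
  qed
qed simp

section \<open>Matrices acting on one factor\<close>

locale kron_factors =
  fixes n :: "nat \<Rightarrow> nat" and d N :: nat
  assumes factor_pos: "k \<in> {1..d} \<Longrightarrow> n k > 0"
    and N_eq: "N = (\<Prod>k=1..d. n k)"
begin

text \<open>For \<open>i\<close> in \<open>{1..d}\<close> this is the squared Frobenius norm of the
  identity on all factors but \<open>i\<close>, hence the scale by which
  \<open>id_kron n d i\<close> multiplies inner products.\<close>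

definition cofactor :: "nat \<Rightarrow> real" where
  "cofactor i = (\<Prod>j\<in>{1..d} - {i}. real (n j))"

lemma cofactor_pos: "cofactor i > 0"
  unfolding cofactor_def using factor_pos by (intro prod_pos) auto

lemma prod_list_upt: "prod_list (map f [1..<Suc d]) = (\<Prod>k=1..d. f k)"
  for f :: "nat \<Rightarrow> 'a::comm_monoid_mult"
  by (simp only: prod.distinct_set_conv_list[OF distinct_upt, symmetric] set_upt
      atLeastLessThanSuc_atLeastAtMost)

text \<open>The function-update form matches \<open>kron_list_entry\<close>.\<close>

lemma id_kron_eq: "id_kron n d i B = kron_list (map ((\<lambda>j. 1\<^sub>m (n j))(i := B)) [1..<Suc d])"
  unfolding id_kron_def by (intro arg_cong[of _ _ kron_list] map_cong) auto

lemma id_kron_carrier: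
  assumes "B \<in> carrier_mat (n i) (n i)"
  shows "id_kron n d i B \<in> carrier_mat N N"
proof -
  have "id_kron n d i B \<in> carrier_mat (prod_list (map n [1..<Suc d])) (prod_list (map n [1..<Suc d]))"
    unfolding id_kron_eq using assms by (intro kron_list_carrier) auto
  then show ?thesis unfolding prod_list_upt N_eq .
qed

lemma frob_inner_id_kron_prod:
  assumes "B \<in> carrier_mat (n i) (n i)" "C \<in> carrier_mat (n k) (n k)"
  shows "frob_inner (id_kron n d i B) (id_kron n d k C) = (\<Prod>j=1..d.
    frob_inner (if j = i then B else 1\<^sub>m (n j)) (if j = k then C else 1\<^sub>m (n j)))"
  unfolding id_kron_def prod_list_upt[symmetric]
  using assms by (intro frob_inner_kron_list) auto

text \<open>Position \<open>i\<close> contributes the inner product of \<open>B\<close> and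
  \<open>C\<close>; every other position \<open>j\<close> pairs two identities and contributes
  \<open>n j\<close>.\<close>

lemma frob_inner_id_kron_same:
  assumes "i \<in> {1..d}" "B \<in> carrier_mat (n i) (n i)" "C \<in> carrier_mat (n i) (n i)"
  shows "frob_inner (id_kron n d i B) (id_kron n d i C) = cofactor i * frob_inner B C"
proof -
  have "(\<Prod>j=1..d. frob_inner (if j = i then B else 1\<^sub>m (n j)) (if j = i then C else 1\<^sub>m (n j)))
      = frob_inner B C * cofactor i"
    unfolding cofactor_def using assms(1)
    by (subst prod.remove[of _ i]) (auto simp: frob_inner_one_one intro!: prod.cong)
  then show ?thesis
    using assms by (simp add: frob_inner_id_kron_prod)
qed

text \<open>Position \<open>i\<close> pairs \<open>B\<close> with an identity, so the product
  contains the factor \<open>mat_tr B\<close>, which vanishes.\<close>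

lemma frob_inner_id_kron_distinct:
  assumes "i \<in> {1..d}" "i \<noteq> k" "B \<in> carrier_mat (n i) (n i)" "C \<in> carrier_mat (n k) (n k)"
    and "mat_tr B = 0"
  shows "frob_inner (id_kron n d i B) (id_kron n d k C) = 0"
proof -
  have "frob_inner B (1\<^sub>m (n i)) = 0"
    using assms by (simp add: frob_inner_commute[of B "n i" "n i"] flip: mat_tr_eq_frob_inner)
  then show ?thesis
    unfolding frob_inner_id_kron_prod[OF assms(3,4)]
    using assms(1,2) by (intro prod_zero) auto
qed

lemma id_kron_one: "id_kron n d i (1\<^sub>m (n i)) = 1\<^sub>m N"
proof -
  have "id_kron n d i (1\<^sub>m (n i)) = kron_list (map (\<lambda>j. 1\<^sub>m (n j)) [1..<Suc d])"
    unfolding id_kron_def by (intro arg_cong[of _ _ kron_list] map_cong) auto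
  then show ?thesis unfolding kron_list_one prod_list_upt N_eq .
qed

text \<open>The trace is the pairing with the identity of size \<open>N\<close>, itself the image of
  the identity of size \<open>n i\<close>; so \<open>frob_inner_id_kron_same\<close>
  applies.\<close>

lemma mat_tr_id_kron:
  assumes "i \<in> {1..d}" "B \<in> carrier_mat (n i) (n i)"
  shows "mat_tr (id_kron n d i B) = cofactor i * mat_tr B"
  using frob_inner_id_kron_same[OF assms(1) one_carrier_mat assms(2)]
  by (simp only: id_kron_one mat_tr_eq_frob_inner[OF assms(2)]
      mat_tr_eq_frob_inner[OF id_kron_carrier[OF assms(2)]])

lemma id_kron_entry:
  assumes "i \<in> {1..d}"
  obtains r w where "\<And>p. p < N \<Longrightarrow> r p < n i"
    and "\<And>B p q. B \<in> carrier_mat (n i) (n i) \<Longrightarrow> p < N \<Longrightarrow> q < N \<Longrightarrow>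
      id_kron n d i B $$ (p, q) = B $$ (r p, r q) * w p q"
proof (rule kron_list_entry[of "[1..<Suc d]" i "\<lambda>j. 1\<^sub>m (n j)" n, unfolded prod_list_upt,
      folded id_kron_eq N_eq])
  show "i \<in> set [1..<Suc d]" using assms by auto
qed (auto intro: that)

lemma id_kron_linear:
  assumes "i \<in> {1..d}" "B \<in> carrier_mat (n i) (n i)" "C \<in> carrier_mat (n i) (n i)"
  shows id_kron_add: "id_kron n d i (B + C) = id_kron n d i B + id_kron n d i C"
    and id_kron_diff: "id_kron n d i (B - C) = id_kron n d i B - id_kron n d i C"
proof -
  obtain r w where r: "\<And>p. p < N \<Longrightarrow> r p < n i"
    and w: "\<And>B p q. B \<in> carrier_mat (n i) (n i) \<Longrightarrow> p < N \<Longrightarrow> q < N \<Longrightarrow>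
      id_kron n d i B $$ (p, q) = B $$ (r p, r q) * w p q"
    using id_kron_entry[OF assms(1)] by blast
  have BC: "B + C \<in> carrier_mat (n i) (n i)" "B - C \<in> carrier_mat (n i) (n i)"
    using assms by auto
  have K: "id_kron n d i V \<in> carrier_mat N N" if "V \<in> carrier_mat (n i) (n i)" for V
    using that by (rule id_kron_carrier)
  note carr = assms(2,3) BC K[OF assms(2)] K[OF assms(3)] K[OF BC(1)] K[OF BC(2)]
  show "id_kron n d i (B + C) = id_kron n d i B + id_kron n d i C"
    using carr r by (intro eq_matI) (auto simp: w algebra_simps)
  show "id_kron n d i (B - C) = id_kron n d i B - id_kron n d i C"
    using carr r by (intro eq_matI) (auto simp: w algebra_simps)
qed

text \<open>The witness is the partial trace of \<open>A\<close> over the other factors, divided by \<open>cofactor i\<close>.\<close>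

lemma id_kron_adjoint:
  assumes "i \<in> {1..d}" "A \<in> carrier_mat N N"
  obtains B where "B \<in> carrier_mat (n i) (n i)"
    and "\<And>V. V \<in> carrier_mat (n i) (n i) \<Longrightarrow>
      frob_inner A (id_kron n d i V) = cofactor i * frob_inner B V"
proof -
  obtain r w where r: "\<And>p. p < N \<Longrightarrow> r p < n i"
    and w: "\<And>B p q. B \<in> carrier_mat (n i) (n i) \<Longrightarrow> p < N \<Longrightarrow> q < N \<Longrightarrow>
      id_kron n d i B $$ (p, q) = B $$ (r p, r q) * w p q"
    using id_kron_entry[OF assms(1)] by blast
  let ?P = "{..<N} \<times> {..<N}" and ?I = "{..<n i} \<times> {..<n i}"
  let ?t = "\<lambda>(p, q). (r p, r q)"
  \<comment> \<open>\<open>S ab\<close> collects the weighted entries of \<open>A\<close> at all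
    positions where \<open>id_kron\<close> reads the entry \<open>ab\<close> of its argument.
    Dividing by the cofactor cancels the scale in the claimed identity.\<close>
  define S where "S ab = (\<Sum>(p, q)\<in>{pq \<in> ?P. ?t pq = ab}. A $$ (p, q) * w p q)" for ab
  define B where "B = mat (n i) (n i) (\<lambda>ab. S ab / cofactor i)"
  have B: "B \<in> carrier_mat (n i) (n i)"
    unfolding B_def by simp
  have "frob_inner A (id_kron n d i V) = cofactor i * frob_inner B V"
    if V: "V \<in> carrier_mat (n i) (n i)" for V
  proof -
    have "frob_inner A (id_kron n d i V) = (\<Sum>(p, q)\<in>?P. A $$ (p, q) * w p q * V $$ ?t (p, q))"
      using w[OF V] assms(2) id_kron_carrier[OF V]
      by (simp add: frob_inner_eq_sum[of _ N N] sum.cartesian_product mult_ac)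
    \<comment> \<open>Regrouping by fibres of the position map; the bound on \<open>r\<close> puts
      every image into \<open>?I\<close>.\<close>
    also have "\<dots> = (\<Sum>ab\<in>?I. \<Sum>(p, q)\<in>{pq \<in> ?P. ?t pq = ab}. A $$ (p, q) * w p q * V $$ ?t (p, q))"
      using r by (intro sum.group[symmetric]) auto
    also have "\<dots> = (\<Sum>ab\<in>?I. S ab * V $$ ab)"
      unfolding S_def sum_distrib_right by (intro sum.cong) auto
    also have "\<dots> = cofactor i * (\<Sum>ab\<in>?I. B $$ ab * V $$ ab)"
      unfolding sum_distrib_left B_def using cofactor_pos[of i] by (intro sum.cong) auto
    also have "\<dots> = cofactor i * frob_inner B V"
      using V by (simp add: frob_inner_eq_sum[OF B V] sum.cartesian_product case_prod_unfold)
    finally show ?thesis .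
  qed
  then show thesis
    by (intro that[of B] B)
qed

section \<open>Orthogonality of the summands and the direct sum\<close>

text \<open>\<open>id_kron\<close> multiplies traces by the positive cofactor, so the image is
  traceless exactly when the small matrix is.\<close>

lemma Delta_summand_eq:
  assumes "i \<in> {1..d}"
  shows "Delta_summand n d i = id_kron n d i ` {B \<in> carrier_mat (n i) (n i). mat_tr B = 0}"
proof -
  have "Delta_summand n d i = {Z \<in> id_kron n d i ` carrier_mat (n i) (n i). mat_tr Z = 0}"
    unfolding Delta_summand_def N_eq[symmetric] using id_kron_carrier by (intro orth_compl_in_span_id) auto
  also have "\<dots> = id_kron n d i ` {B \<in> carrier_mat (n i) (n i). mat_tr (id_kron n d i B) = 0}"
    by blast
  also have "\<dots> = id_kron n d i ` {B \<in> carrier_mat (n i) (n i). mat_tr B = 0}"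
    using cofactor_pos[of i]
    by (intro arg_cong[of _ _ "image _"] Collect_cong) (simp cong: conj_cong add: mat_tr_id_kron[OF assms])
  finally show ?thesis .
qed

lemma Delta_summand_carrier:
  assumes "i \<in> {1..d}" "Y \<in> Delta_summand n d i"
  shows "Y \<in> carrier_mat N N"
  using assms by (auto simp: Delta_summand_eq intro: id_kron_carrier)

lemma Delta_summand_diff:
  assumes "i \<in> {1..d}" "Y \<in> Delta_summand n d i" "Z \<in> Delta_summand n d i"
  shows "Y - Z \<in> Delta_summand n d i"
proof -
  obtain B C where "B \<in> carrier_mat (n i) (n i)" "C \<in> carrier_mat (n i) (n i)"
    "mat_tr B = 0" "mat_tr C = 0" "Y = id_kron n d i B" "Z = id_kron n d i C"
    using assms by (auto simp: Delta_summand_eq)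
  then show ?thesis
    unfolding Delta_summand_eq[OF assms(1)] using assms(1)
    by (intro image_eqI[of _ _ "B - C"]) (auto simp: id_kron_diff mat_tr_diff)
qed

lemma Delta_summands_orthogonal:
  assumes "i \<in> {1..d}" "k \<in> {1..d}" "i \<noteq> k" "Y \<in> Delta_summand n d i" "Z \<in> Delta_summand n d k"
  shows "frob_inner Y Z = 0"
  using assms by (auto simp: Delta_summand_eq frob_inner_id_kron_distinct)

text \<open>Pairing with an element of the \<open>i\<close>-th summand annihilates all other terms,
  so it isolates the \<open>i\<close>-th component of a sum.\<close>

lemma frob_inner_Delta_sum:
  assumes "i \<in> {1..d}" "W \<in> Delta_summand n d i" "Y \<in> (\<Pi> k\<in>{1..d}. Delta_summand n d k)"
  shows "frob_inner W (\<Oplus>\<^bsub>mats N\<^esub>k\<in>{1..d}. Y k) = frob_inner W (Y i)"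
proof -
  have "frob_inner W (\<Oplus>\<^bsub>mats N\<^esub>k\<in>{1..d}. Y k) = (\<Sum>k=1..d. frob_inner W (Y k))"
    using assms(1,2) Delta_summand_carrier[OF _ Pi_mem[OF assms(3)]]
    by (intro frob_inner_finsum) (auto intro: Delta_summand_carrier)
  also have "\<dots> = (\<Sum>k=1..d. if k = i then frob_inner W (Y i) else 0)"
  proof (intro sum.cong refl)
    fix k assume "k \<in> {1..d}"
    then show "frob_inner W (Y k) = (if k = i then frob_inner W (Y i) else 0)"
      using Delta_summands_orthogonal[OF assms(1) _ _ assms(2) Pi_mem[OF assms(3)]] by simp
  qed
  finally show ?thesis
    using assms(1) by simp
qed

lemma Delta_is_internal_direct_sum:
  "is_internal_direct_sum N {1..d} (Delta_summand n d) (Delta n d)"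
proof -
  have unique: "Y = Y'" if Y: "Y \<in> (\<Pi>\<^sub>E i\<in>{1..d}. Delta_summand n d i)"
    and Y': "Y' \<in> (\<Pi>\<^sub>E i\<in>{1..d}. Delta_summand n d i)"
    and eq: "(\<Oplus>\<^bsub>mats N\<^esub>i\<in>{1..d}. Y i) = (\<Oplus>\<^bsub>mats N\<^esub>i\<in>{1..d}. Y' i)" for Y Y'
  proof (rule PiE_ext[OF Y Y'])
    fix i assume i: "i \<in> {1..d}"
    have Yi: "Y i \<in> Delta_summand n d i" "Y' i \<in> Delta_summand n d i"
      using Y Y' i by auto
    note carr = Yi[THEN Delta_summand_carrier[OF i]]
    \<comment> \<open>Both sums are equal; pairing them with \<open>Y i - Y' i\<close> isolates the
      \<open>i\<close>-th components, whose difference is then orthogonal to itself.\<close>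
    have "frob_inner (Y i - Y' i) (Y i) = frob_inner (Y i - Y' i) (Y' i)"
      using frob_inner_Delta_sum[OF i Delta_summand_diff[OF i Yi], of Y]
        frob_inner_Delta_sum[OF i Delta_summand_diff[OF i Yi], of Y'] Y Y' eq
      by (auto simp: PiE_def)
    then have "frob_inner (Y i - Y' i) (Y i - Y' i) = 0"
      using carr by (subst frob_inner_diff_right[of _ N N]) auto
    then show "Y i = Y' i"
      using frob_inner_self_diff_pos[OF carr] by fastforce
  qed
  have "\<exists>!Y. Y \<in> (\<Pi>\<^sub>E i\<in>{1..d}. Delta_summand n d i) \<and> Z = (\<Oplus>\<^bsub>mats N\<^esub>i\<in>{1..d}. Y i)"
    if Z: "Z \<in> Delta n d" for Z
  proof -
    obtain Y where Y: "Y \<in> (\<Pi> i\<in>{1..d}. Delta_summand n d i)" "Z = (\<Oplus>\<^bsub>mats N\<^esub>i\<in>{1..d}. Y i)"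
      using Z unfolding Delta_def subspace_family_sum_def N_eq[symmetric] by auto
    \<comment> \<open>Uniqueness is claimed among extensional families, whereas membership in
      \<open>Delta\<close> yields an arbitrary one; restriction passes between them.\<close>
    have "(\<Oplus>\<^bsub>mats N\<^esub>i\<in>{1..d}. Y i) = (\<Oplus>\<^bsub>mats N\<^esub>i\<in>{1..d}. restrict Y {1..d} i)"
      using Delta_summand_carrier[OF _ Pi_mem[OF Y(1)]] by (intro finsum_mats_cong) auto
    then have "Z = (\<Oplus>\<^bsub>mats N\<^esub>i\<in>{1..d}. restrict Y {1..d} i)"
      using Y(2) by simp
    moreover have "restrict Y {1..d} \<in> (\<Pi>\<^sub>E i\<in>{1..d}. Delta_summand n d i)"
      using Y(1) by (simp add: restrict_PiE_iff Pi_iff)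
    ultimately show ?thesis
      using unique by (metis (no_types, lifting))
  qed
  then show ?thesis
    by (simp add: is_internal_direct_sum_def Delta_def N_eq)
qed

section \<open>A single update of the iteration\<close>

text \<open>\<open>S\<close> and \<open>T\<close> stand for the contributions of the earlier and
  later factors. Being orthogonal to all feasible directions, they do not affect the minimizer,
  which moves the coefficient from \<open>Y\<close> to the value \<open>B\<close> representing
  \<open>A\<close> on factor \<open>i\<close>.\<close>

lemma sweep_step:
  assumes i: "i \<in> {1..d}"
    and carr: "A \<in> carrier_mat N N" "S \<in> carrier_mat N N" "T \<in> carrier_mat N N"
      "B \<in> carrier_mat (n i) (n i)" "Y \<in> carrier_mat (n i) (n i)"
    and tr: "mat_tr B = 0" "mat_tr Y = 0"
    and A: "\<And>V. V \<in> carrier_mat (n i) (n i) \<Longrightarrow>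
      frob_inner A (id_kron n d i V) = cofactor i * frob_inner B V"
    and S: "\<And>V. V \<in> carrier_mat (n i) (n i) \<Longrightarrow> mat_tr V = 0 \<Longrightarrow> frob_inner (id_kron n d i V) S = 0"
    and T: "\<And>V. V \<in> carrier_mat (n i) (n i) \<Longrightarrow> mat_tr V = 0 \<Longrightarrow> frob_inner (id_kron n d i V) T = 0"
  shows "arg_min_on (\<lambda>V. frob_norm (A - (S + id_kron n d i (Y + V) + T)))
    (orth_compl_in (carrier_mat (n i) (n i)) (span_id (n i))) = B - Y"
  unfolding orth_compl_in_span_id[OF subset_refl]
proof (rule arg_min_on_unique)
  let ?K = "id_kron n d i"
  define R where "R = A - (S + ?K B + T)"
  have KB: "?K B \<in> carrier_mat N N" using carr by (intro id_kron_carrier)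
  have R: "R \<in> carrier_mat N N" using carr KB unfolding R_def by auto
  show "B - Y \<in> {V \<in> carrier_mat (n i) (n i). mat_tr V = 0}"
    using carr tr by (auto simp: mat_tr_diff)
  fix V assume V: "V \<in> {V \<in> carrier_mat (n i) (n i). mat_tr V = 0}" "V \<noteq> B - Y"
  \<comment> \<open>The deviation of a competitor from the claimed minimizer; it is again traceless,
    so \<open>S\<close> and \<open>T\<close> are orthogonal to its image.\<close>
  define D where "D = V - (B - Y)"
  have D: "D \<in> carrier_mat (n i) (n i)" "mat_tr D = 0"
    using V carr tr mat_tr_diff[OF _ minus_carrier_mat[OF carr(5)], of V B] mat_tr_diff[OF carr(4,5)]
    unfolding D_def by auto
  have KD: "?K D \<in> carrier_mat N N" using D by (intro id_kron_carrier)
  have "Y + (B - Y) = B" "Y + V = B + D"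
    using carr V unfolding D_def by auto
  then have res_min: "A - (S + ?K (Y + (B - Y)) + T) = R"
    and res: "A - (S + ?K (Y + V) + T) = R - ?K D"
    using carr D KB KD unfolding R_def
    by (auto simp: id_kron_add[OF i] intro!: eq_matI)
  \<comment> \<open>The optimal residual is orthogonal to the deviation: \<open>A\<close> and
    \<open>?K B\<close> have the same pairing with \<open>?K D\<close>.\<close>
  have "frob_inner (?K D) R = frob_inner (?K D) A - frob_inner (?K D) (?K B)"
  proof -
    have "frob_inner (?K D) (S + ?K B + T) = frob_inner (?K D) (?K B)"
      using carr KB KD S[OF D] T[OF D] by (simp add: frob_inner_add_right[of _ N N])
    then show ?thesis
      unfolding R_def using carr KB KD by (subst frob_inner_diff_right[of _ N N]) auto
  qed
  also have "\<dots> = 0"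
    using A[OF D(1)] carr D KD frob_inner_id_kron_same[OF i D(1) carr(4)]
      frob_inner_commute[of A N N "?K D"] frob_inner_commute[of B "n i" "n i" D] by simp
  finally have "frob_inner (R - ?K D) (R - ?K D) = frob_inner R R + frob_inner (?K D) (?K D)"
    using R KD by (intro frob_pythagoras) (auto simp: frob_inner_commute[of R N N])
  moreover have "frob_inner (?K D) (?K D) > 0"
    using frob_inner_self_diff_pos[OF _ minus_carrier_mat[OF carr(5)], of V B] V
      cofactor_pos[of i] D(1)
    by (simp add: frob_inner_id_kron_same[OF i] D_def)
  ultimately show "frob_norm (A - (S + ?K (Y + (B - Y)) + T)) < frob_norm (A - (S + ?K (Y + V) + T))"
    unfolding res res_min by (simp add: frob_norm_eq)
qed

text \<open>Supplies the orthogonality conditions on \<open>S\<close> and \<open>T\<close> in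
  \<open>sweep_step\<close>.\<close>

lemma frob_inner_id_kron_finsum:
  assumes "i \<in> {1..d}" "V \<in> carrier_mat (n i) (n i)" "mat_tr V = 0" "finite I" "i \<notin> I"
    and "\<And>k. k \<in> I \<Longrightarrow> B k \<in> carrier_mat (n k) (n k)"
  shows "frob_inner (id_kron n d i V) (\<Oplus>\<^bsub>mats N\<^esub>k\<in>I. id_kron n d k (B k)) = 0"
proof -
  have "frob_inner (id_kron n d i V) (\<Oplus>\<^bsub>mats N\<^esub>k\<in>I. id_kron n d k (B k))
      = (\<Sum>k\<in>I. frob_inner (id_kron n d i V) (id_kron n d k (B k)))"
    using assms by (intro frob_inner_finsum id_kron_carrier)
  also have "\<dots> = 0"
    using assms by (intro sum.neutral) (metis frob_inner_id_kron_distinct)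
  finally show ?thesis .
qed

section \<open>The projection onto \<open>Delta\<close>\<close>

text \<open>The difference between the sum and \<open>A\<close> is orthogonal to
  \<open>Delta\<close>, since on each summand the two have the same pairings; Pythagoras then makes
  the sum the strict minimizer.\<close>

lemma orth_proj_Delta:
  assumes A: "A \<in> carrier_mat N N"
    and B: "\<And>i. i \<in> {1..d} \<Longrightarrow> B i \<in> carrier_mat (n i) (n i)"
      "\<And>i. i \<in> {1..d} \<Longrightarrow> mat_tr (B i) = 0"
    and adj: "\<And>i V. i \<in> {1..d} \<Longrightarrow> V \<in> carrier_mat (n i) (n i) \<Longrightarrow>
      frob_inner A (id_kron n d i V) = cofactor i * frob_inner (B i) V"
  shows "orth_proj (Delta n d) A = (\<Oplus>\<^bsub>mats N\<^esub>k\<in>{1..d}. id_kron n d k (B k))"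
  unfolding orth_proj_def
proof (rule arg_min_on_unique)
  let ?P = "\<Oplus>\<^bsub>mats N\<^esub>k\<in>{1..d}. id_kron n d k (B k)"
  have KB: "(\<lambda>k. id_kron n d k (B k)) \<in> (\<Pi> k\<in>{1..d}. Delta_summand n d k)"
    using B by (auto simp: Delta_summand_eq)
  then show P: "?P \<in> Delta n d"
    by (auto simp: Delta_def subspace_family_sum_def N_eq)
  have Delta_carrier: "Z \<in> carrier_mat N N" if "Z \<in> Delta n d" for Z
    using that unfolding Delta_def subspace_family_sum_def N_eq[symmetric]
    by (auto intro!: finsum_mats_closed Delta_summand_carrier)
  have orth: "frob_inner (?P - A) Z = 0" if "Z \<in> Delta n d" for Z
  proof -
    obtain Y where Y: "Y \<in> (\<Pi> i\<in>{1..d}. Delta_summand n d i)" "Z = (\<Oplus>\<^bsub>mats N\<^esub>i\<in>{1..d}. Y i)"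
      using \<open>Z \<in> Delta n d\<close> by (auto simp: Delta_def subspace_family_sum_def N_eq)
    have "frob_inner (?P - A) Z = (\<Sum>i=1..d. frob_inner (?P - A) (Y i))"
      unfolding Y(2) using Delta_summand_carrier[OF _ Pi_mem[OF Y(1)]] A Delta_carrier[OF P]
      by (intro frob_inner_finsum) auto
    also have "\<dots> = 0"
    proof (rule sum.neutral, rule ballI)
      fix i assume i: "i \<in> {1..d}"
      obtain V where V: "V \<in> carrier_mat (n i) (n i)" "Y i = id_kron n d i V"
        using Pi_mem[OF Y(1) i] unfolding Delta_summand_eq[OF i] by auto
      have "Y i \<in> Delta_summand n d i" using Y(1) i by auto
      then have Yi: "Y i \<in> carrier_mat N N" using i by (rule Delta_summand_carrier[rotated])
      \<comment> \<open>Only the \<open>i\<close>-th term of \<open>?P\<close> survives, and its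
        cofactor is the one in the representation of \<open>A\<close>.\<close>
      have "frob_inner ?P (Y i) = frob_inner (Y i) (id_kron n d i (B i))"
        using frob_inner_Delta_sum[OF i \<open>Y i \<in> Delta_summand n d i\<close> KB]
        by (simp only: frob_inner_commute[OF Delta_carrier[OF P] Yi])
      also have "\<dots> = frob_inner A (Y i)"
        using adj[OF i V(1)] frob_inner_id_kron_same[OF i V(1) B(1)[OF i]]
        by (simp add: V(2) frob_inner_commute[OF V(1) B(1)[OF i]])
      finally show "frob_inner (?P - A) (Y i) = 0"
        using A Yi Delta_carrier[OF P] by (simp add: frob_inner_diff_left[of _ N N])
    qed
    finally show ?thesis .
  qed
  fix Z assume Z: "Z \<in> Delta n d" "Z \<noteq> ?P"
  note carr = A Delta_carrier[OF P] Delta_carrier[OF Z(1)]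
  have "frob_inner (?P - A) (?P - Z) = 0"
    using carr orth[OF P] orth[OF Z(1)] by (subst frob_inner_diff_right[of _ N N]) auto
  then have "frob_inner ((?P - A) - (?P - Z)) ((?P - A) - (?P - Z))
      = frob_inner (?P - A) (?P - A) + frob_inner (?P - Z) (?P - Z)"
    using carr by (intro frob_pythagoras[of _ N N]) auto
  moreover have "(?P - A) - (?P - Z) = Z - A"
    using carr by (intro eq_matI) auto
  moreover have "frob_inner (?P - Z) (?P - Z) > 0"
    using Z carr by (intro frob_inner_self_diff_pos) auto
  ultimately show "frob_norm (?P - A) < frob_norm (Z - A)"
    by (simp add: frob_norm_eq)
qed

end

section \<open>Convergence of the iteration\<close>

text \<open>Convergence is expressed by the Frobenius norm of the difference tending to zero; the
  first conjunct accounts for the direct-sum sign in the description of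
  \<open>Delta\<close>.\<close>

theorem theorem3:
  fixes d N :: nat and n :: "nat \<Rightarrow> nat" and A :: "real mat"
    and X U :: "nat \<Rightarrow> nat \<Rightarrow> real mat"
  assumes "d \<ge> 1"
    and "\<And>k. k \<in> {1..d} \<Longrightarrow> n k > 0"
    and "N = (\<Prod>k=1..d. n k)"
    and "A \<in> carrier_mat N N"
    and "mat_tr A = 0"
    and "\<And>k. k \<in> {1..d} \<Longrightarrow> X k 0 = 0\<^sub>m (n k) (n k)"
    and "\<And>l i. l \<ge> 1 \<Longrightarrow> i \<in> {1..d} \<Longrightarrow>
      U i l = arg_min_on
        (\<lambda>V. frob_norm (A -
           ((\<Oplus>\<^bsub>mats N\<^esub>k\<in>{1..<i}. id_kron n d k (X k l))
            + id_kron n d i (X i (l - 1) + V)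
            + (\<Oplus>\<^bsub>mats N\<^esub>k\<in>{i+1..d}. id_kron n d k (X k (l - 1))))))
        (orth_compl_in (carrier_mat (n i) (n i)) (span_id (n i)))"
    and "\<And>l i. l \<ge> 1 \<Longrightarrow> i \<in> {1..d} \<Longrightarrow> X i l = X i (l - 1) + U i l"
  shows "is_internal_direct_sum N {1..d} (Delta_summand n d) (Delta n d) \<and>
         (\<lambda>l. frob_norm ((\<Oplus>\<^bsub>mats N\<^esub>k\<in>{1..d}. id_kron n d k (X k l)) - orth_proj (Delta n d) A))
         \<longlonglongrightarrow> 0"
proof
  interpret kron_factors n d N by unfold_locales (fact assms(2), fact assms(3))
  show "is_internal_direct_sum N {1..d} (Delta_summand n d) (Delta n d)"
    by (rule Delta_is_internal_direct_sum)
  note A = assms(4)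
  have "\<exists>B. B \<in> carrier_mat (n i) (n i) \<and> (\<forall>V\<in>carrier_mat (n i) (n i).
      frob_inner A (id_kron n d i V) = cofactor i * frob_inner B V)" if "i \<in> {1..d}" for i
    using id_kron_adjoint[OF that A] by metis
  then obtain B where B: "\<And>i. i \<in> {1..d} \<Longrightarrow> B i \<in> carrier_mat (n i) (n i)"
    and adj: "\<And>i V. i \<in> {1..d} \<Longrightarrow> V \<in> carrier_mat (n i) (n i) \<Longrightarrow>
      frob_inner A (id_kron n d i V) = cofactor i * frob_inner (B i) V"
    by metis
  \<comment> \<open>Testing the representation of \<open>A\<close> on the identity gives the trace
    of \<open>A\<close>.\<close>
  have trB: "mat_tr (B i) = 0" if i: "i \<in> {1..d}" for i
  proof -
    have "cofactor i * mat_tr (B i) = mat_tr A"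
      using adj[OF i one_carrier_mat] A B[OF i]
      by (simp add: id_kron_one mat_tr_eq_frob_inner frob_inner_commute[of _ _ _ "1\<^sub>m _"])
    then show ?thesis
      using assms(5) cofactor_pos[of i] by simp
  qed
  \<comment> \<open>Within a sweep the factors before \<open>i\<close> carry new values and those
    after \<open>i\<close> old ones; both sums are orthogonal to the feasible directions of factor
    \<open>i\<close>.\<close>
  have step: "X i (Suc l) = B i" if i: "i \<in> {1..d}"
    and old: "\<And>k. k \<in> {1..d} \<Longrightarrow> X k l \<in> carrier_mat (n k) (n k) \<and> mat_tr (X k l) = 0"
    and new: "\<And>k. k \<in> {1..<i} \<Longrightarrow> X k (Suc l) \<in> carrier_mat (n k) (n k)" for i l
  proof -
    have "U i (Suc l) = B i - X i l"
      unfolding assms(7)[OF _ i, of "Suc l", simplified]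
      using i old new by (intro sweep_step A B trB adj finsum_mats_closed id_kron_carrier
          frob_inner_id_kron_finsum) auto
    then have "X i (Suc l) = X i l + (B i - X i l)"
      using assms(8)[OF _ i, of "Suc l"] by simp
    then show ?thesis
      using B[OF i] old[OF i] by auto
  qed
  \<comment> \<open>Strong induction along the sweep: factors before \<open>i\<close> have already
    reached \<open>B\<close>, hence have the right dimensions.\<close>
  have sweep: "X i (Suc l) = B i" if i: "i \<in> {1..d}"
    and old: "\<And>k. k \<in> {1..d} \<Longrightarrow> X k l \<in> carrier_mat (n k) (n k) \<and> mat_tr (X k l) = 0" for i l
    using i
  proof (induction i rule: less_induct)
    case (less i)
    then show ?case
      using B by (intro step old) auto
  qed
  \<comment> \<open>The first sweep starts from zero matrices and later ones from the
    \<open>B i\<close>; both are traceless, so every sweep ends at \<open>B\<close>.\<close>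
  have X: "X i (Suc l) = B i" if "i \<in> {1..d}" for i l
    using that
  proof (induction l arbitrary: i)
    case 0
    then show ?case
      using assms(6) by (intro sweep) (auto simp: mat_tr_def)
  next
    case (Suc l)
    then show ?case
      using B trB by (intro sweep) auto
  qed
  define P where "P = (\<Oplus>\<^bsub>mats N\<^esub>k\<in>{1..d}. id_kron n d k (B k))"
  have KB: "id_kron n d k (B k) \<in> carrier_mat N N" if "k \<in> {1..d}" for k
    by (rule id_kron_carrier[OF B[OF that]])
  have "P \<in> carrier_mat N N"
    unfolding P_def by (rule finsum_mats_closed) (rule KB)
  then have "frob_norm (P - P) = 0"
    by (simp add: frob_norm_eq frob_inner_zero_right[of _ N N])
  moreover have "orth_proj (Delta n d) A = P"
    unfolding P_def using B trB adj by (intro orth_proj_Delta A)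
  \<comment> \<open>The sum equals \<open>P\<close> from the first sweep on. The initial term is
    built from zero matrices, hence the shift by one before taking the limit.\<close>
  moreover have "(\<Oplus>\<^bsub>mats N\<^esub>k\<in>{1..d}. id_kron n d k (X k (Suc l))) = P" for l
    unfolding P_def using X KB by (intro finsum_mats_cong) simp_all
  ultimately have "(\<lambda>l. frob_norm ((\<Oplus>\<^bsub>mats N\<^esub>k\<in>{1..d}. id_kron n d k (X k (Suc l)))
      - orth_proj (Delta n d) A)) = (\<lambda>_. 0)"
    by simp
  then have "(\<lambda>l. frob_norm ((\<Oplus>\<^bsub>mats N\<^esub>k\<in>{1..d}. id_kron n d k (X k (Suc l)))
      - orth_proj (Delta n d) A)) \<longlonglongrightarrow> 0"
    by simp
  then show "(\<lambda>l. frob_norm ((\<Oplus>\<^bsub>mats N\<^esub>k\<in>{1..d}. id_kron n d k (X k l))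
      - orth_proj (Delta n d) A)) \<longlonglongrightarrow> 0"
    by (rule LIMSEQ_imp_Suc)
qed

end
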